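(* For every nonnegative integer $k$, the $k^{\rm th}$ upper chromatic number $\chi^k(\mathbb{R})$ of the real line is finite.
   Context: Let $S\subseteq\mathbb{R}^n$ and $k,m\in\mathbb{N}$, and let $D=(d_{ij})$ be a $k\times m$ array of positive real numbers. $S$ is called $D$-colorable if there is a coloring $T:S\to\{C_1,\dots,C_m\}$ such that for all $1\le i\le k$ and $1\le j\le m$, no two points of $S$ at Euclidean distance $d_{ij}$ are both colored $C_j$. The $k^{\rm th}$ upper chromatic number $\chi^k(S)$ is the smallest integer $m$ such that $S$ is $D$-colorable for every $k\times m$ array $D$ of positive reals; if no such integer exists, $\chi^k(S)=\infty$. (For $k=0$, $\chi^0(S)=1$ for nonempty $S$.) *)

theory Defs
  imports "HOL-Analysis.Analysis" "HOL-Library.Extended_Nat"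
begin

text \<open>
  A $k \times m$ array is a function \<open>D :: nat \<Rightarrow> nat \<Rightarrow> real\<close> of which only the entries
  \<open>D i j\<close> with \<open>1 \<le> i \<le> k\<close> and \<open>1 \<le> j \<le> m\<close> are relevant; the colour $C_j$ is the number \<open>j\<close>.
\<close>

definition positive_array :: "nat \<Rightarrow> nat \<Rightarrow> (nat \<Rightarrow> nat \<Rightarrow> real) \<Rightarrow> bool" where
  "positive_array k m D \<longleftrightarrow> (\<forall>i\<in>{1..k}. \<forall>j\<in>{1..m}. D i j > 0)"

definition array_colorable ::
  "nat \<Rightarrow> nat \<Rightarrow> (nat \<Rightarrow> nat \<Rightarrow> real) \<Rightarrow> 'a::euclidean_space set \<Rightarrow> bool" where
  "array_colorable k m D S \<longleftrightarrow>
     (\<exists>T \<in> S \<rightarrow> {1..m}. \<forall>i\<in>{1..k}. \<forall>j\<in>{1..m}.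
        \<not> (\<exists>x\<in>S. \<exists>y\<in>S. dist x y = D i j \<and> T x = j \<and> T y = j))"

definition always_colorable :: "nat \<Rightarrow> nat \<Rightarrow> 'a::euclidean_space set \<Rightarrow> bool" where
  "always_colorable k m S \<longleftrightarrow> (\<forall>D. positive_array k m D \<longrightarrow> array_colorable k m D S)"

text \<open>
  The value \<open>m = 0\<close> needs no exclusion: a nonempty \<open>S\<close> has no map into the empty set of
  colours, so in particular the number is 1 for \<open>k = 0\<close> and nonempty \<open>S\<close>.
\<close>

definition upper_chromatic_number :: "nat \<Rightarrow> 'a::euclidean_space set \<Rightarrow> enat" where
  "upper_chromatic_number k S =
     (if \<exists>m. always_colorable k m S then enat (LEAST m. always_colorable k m S) else \<infinity>)"

lemma upper_chromatic_number_0: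
  fixes S :: "'a::euclidean_space set"
  assumes "S \<noteq> {}"
  shows "upper_chromatic_number 0 S = 1"
proof -
  have 1: "always_colorable 0 1 S"
    unfolding always_colorable_def array_colorable_def by auto
  have "\<not> always_colorable 0 0 S"
    using assms unfolding always_colorable_def array_colorable_def positive_array_def by auto
  then have "1 \<le> m" if "always_colorable 0 m S" for m
    using that by (cases m) auto
  with 1 have "(LEAST m. always_colorable 0 m S) = 1"
    by (rule Least_equality)
  with 1 show ?thesis
    unfolding upper_chromatic_number_def by (auto simp: one_enat_def)
qed

end

theory Submission
  imports Defs
begin

text \<open>
  Two points \<open>x\<close>, \<open>y\<close> conflict in colour \<open>j\<close> if their distance is one of the \<open>k\<close> entries of column
  \<open>j\<close>; on the line, a point has at most \<open>2 * k\<close> conflicts in each colour. With \<open>m \<ge> 8 * k\<close> colours,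
  adding a point to a finite set multiplies the number of admissible colourings by at least
  \<open>m / 2\<close>: of the \<open>m\<close> extensions of each colouring, those spoiled by a neighbour \<open>u\<close> of
  colour \<open>j\<close> are determined by colourings of the set without \<open>u\<close>, of which inductively there are
  at most \<open>2 / m\<close> times as many. Hence finite sets are colourable, and compactness of the
  space of all colourings gives the whole line.
\<close>

definition conflict_free :: "('c \<Rightarrow> 'a \<Rightarrow> 'a \<Rightarrow> bool) \<Rightarrow> 'a set \<Rightarrow> ('a \<Rightarrow> 'c) \<Rightarrow> bool" where
  "conflict_free R X f \<longleftrightarrow> (\<forall>x\<in>X. \<forall>y\<in>X. f y = f x \<longrightarrow> \<not> R (f x) x y)"

text \<open>Extensional functions, with the fixed value \<open>undefined\<close> off
  \<open>X\<close>, make the colorings of a finite set a finite set that can be counted.\<close>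

definition conflict_free_colorings ::
  "('c \<Rightarrow> 'a \<Rightarrow> 'a \<Rightarrow> bool) \<Rightarrow> 'c set \<Rightarrow> 'a set \<Rightarrow> ('a \<Rightarrow> 'c) set" where
  "conflict_free_colorings R C X = {f \<in> X \<rightarrow>\<^sub>E C. conflict_free R X f}"

lemma conflict_free_subset:
  "conflict_free R X f \<Longrightarrow> Y \<subseteq> X \<Longrightarrow> conflict_free R Y f"
  unfolding conflict_free_def by blast

lemma conflict_free_cong:
  "(\<And>x. x \<in> X \<Longrightarrow> f x = g x) \<Longrightarrow> conflict_free R X f \<longleftrightarrow> conflict_free R X g"
  unfolding conflict_free_def by auto

lemma finite_conflict_free_colorings:
  assumes "finite C" "finite X"
  shows "finite (conflict_free_colorings R C X)"
  using finite_PiE[of X "\<lambda>_. C"] assms unfolding conflict_free_colorings_def by auto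

text \<open>A coloring with prescribed color at \<open>u\<close> is recovered from its restriction
  to \<open>X - {u}\<close>, so restriction is injective.\<close>

lemma card_colorings_fixed_le:
  assumes "finite C" "finite X" "u \<in> X"
  shows "card {f \<in> conflict_free_colorings R C X. f u = c}
    \<le> card (conflict_free_colorings R C (X - {u}))"
proof (rule card_inj_on_le)
  let ?r = "\<lambda>f. restrict f (X - {u})"
  let ?A = "{f \<in> conflict_free_colorings R C X. f u = c}"
  show "inj_on ?r ?A"
  proof (rule inj_onI)
    fix f g assume f: "f \<in> ?A" and g: "g \<in> ?A" and eq: "?r f = ?r g"
    show "f = g"
    proof (rule PiE_ext)
      show "f \<in> X \<rightarrow>\<^sub>E C" "g \<in> X \<rightarrow>\<^sub>E C"
        using f g unfolding conflict_free_colorings_def by auto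
      show "f x = g x" if "x \<in> X" for x
        using f g that fun_cong[OF eq, of x] by (cases "x = u") auto
    qed
  qed
  show "?r ` ?A \<subseteq> conflict_free_colorings R C (X - {u})"
  proof (rule image_subsetI)
    fix f assume f: "f \<in> ?A"
    then have "conflict_free R (X - {u}) f"
      unfolding conflict_free_colorings_def by (auto intro: conflict_free_subset)
    then have "conflict_free R (X - {u}) (?r f)"
      by (subst conflict_free_cong[of _ _ f]) auto
    then show "?r f \<in> conflict_free_colorings R C (X - {u})"
      using f unfolding conflict_free_colorings_def by auto
  qed
  show "finite (conflict_free_colorings R C (X - {u}))"
    using assms by (simp add: finite_conflict_free_colorings)
qed

text \<open>The growth factor \<open>card C / 2\<close> reproduces itself: at most
  \<open>card C * d\<close> pairs of a color and a neighbor can spoil an extension, each spoiling at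
  most a \<open>2 / card C\<close> fraction of the colorings of \<open>X\<close>. The loss is at
  most \<open>2 * d\<close> times their number, hence at most half of all extensions once
  \<open>4 * d \<le> card C\<close>. Mere existence of a coloring would be too weak an induction
  hypothesis.\<close>

lemma card_colorings_insert:
  assumes C: "finite C"
    and sym: "\<And>c x y. c \<in> C \<Longrightarrow> R c x y \<Longrightarrow> R c y x"
    and irrefl: "\<And>c x. c \<in> C \<Longrightarrow> \<not> R c x x"
    and fin: "\<And>c x. c \<in> C \<Longrightarrow> finite {y. R c x y}"
    and deg: "\<And>c x. c \<in> C \<Longrightarrow> card {y. R c x y} \<le> d"
    and d: "4 * d \<le> card C"
  shows "finite X \<Longrightarrow> v \<notin> X \<Longrightarrow>
    card C * card (conflict_free_colorings R C X)
      \<le> 2 * card (conflict_free_colorings R C (insert v X))"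
proof (induction "card X" arbitrary: X v rule: less_induct)
  case less
  define P where "P = conflict_free_colorings R C"
  \<comment> \<open>\<open>B\<close> collects the spoiled extensions: pairs of a color
    \<open>c\<close> for \<open>v\<close> and a coloring \<open>f\<close> in which some neighbor of
    \<open>v\<close> for \<open>c\<close> already has color \<open>c\<close>.\<close>
  define bad where "bad = (SIGMA c:C. {u \<in> X. R c v u})"
  define B where "B = (\<Union>(c, u)\<in>bad. {c} \<times> {f \<in> P X. f u = c})"
  have finP: "finite (P Y)" if "finite Y" for Y
    using C that unfolding P_def by (simp add: finite_conflict_free_colorings)
  have finbad: "finite bad"
    unfolding bad_def using C less.prems by auto
  have finB: "finite B"
    unfolding B_def using finbad finP[OF less.prems(1)] by (auto intro!: finite_cartesian_product)
  have cardbad: "card bad \<le> card C * d"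
  proof -
    have "card bad = (\<Sum>c\<in>C. card {u \<in> X. R c v u})"
      unfolding bad_def using C less.prems by (intro card_SigmaI) auto
    also have "\<dots> \<le> (\<Sum>c\<in>C. d)"
    proof (rule sum_mono)
      fix c assume c: "c \<in> C"
      have "card {u \<in> X. R c v u} \<le> card {u. R c v u}"
        using fin[OF c] by (intro card_mono) auto
      with deg[OF c] show "card {u \<in> X. R c v u} \<le> d" by (rule le_trans[rotated])
    qed
    finally show ?thesis by simp
  qed
  have IH: "card C * card {f \<in> P X. f u = c} \<le> 2 * card (P X)" if u: "u \<in> X" for u c
  proof -
    have "card {f \<in> P X. f u = c} \<le> card (P (X - {u}))"
      unfolding P_def using C less.prems(1) u by (rule card_colorings_fixed_le)
    then have "card C * card {f \<in> P X. f u = c} \<le> card C * card (P (X - {u}))"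
      by simp
    \<comment> \<open>The induction hypothesis is applied to \<open>X - {u}\<close> with
      \<open>u\<close> as the new point; hence the induction on cardinality with \<open>v\<close>
      arbitrary.\<close>
    also have "\<dots> \<le> 2 * card (P (insert u (X - {u})))"
      unfolding P_def using less.prems u by (intro less.hyps card_Diff1_less) auto
    also have "insert u (X - {u}) = X"
      using u by auto
    finally show ?thesis .
  qed
  have "card B \<le> (\<Sum>(c, u)\<in>bad. card {f \<in> P X. f u = c})"
    unfolding B_def using card_UN_le[OF finbad, of "\<lambda>(c, u). {c} \<times> {f \<in> P X. f u = c}"]
    by (simp add: case_prod_unfold card_cartesian_product)
  then have "card C * card B \<le> (\<Sum>(c, u)\<in>bad. card C * card {f \<in> P X. f u = c})"
    by (simp add: case_prod_unfold flip: sum_distrib_left)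
  also have "\<dots> \<le> (\<Sum>(c, u)\<in>bad. 2 * card (P X))"
    using IH by (intro sum_mono) (auto simp: bad_def)
  also have "\<dots> \<le> card C * (2 * d * card (P X))"
    using mult_right_mono[OF cardbad, of "2 * card (P X)"] by (simp add: mult_ac)
  finally have cardB: "card B \<le> 2 * d * card (P X)" if "card C > 0"
    using that by simp
  have "card (C \<times> P X - B) \<le> card (P (insert v X))"
  proof (rule card_inj_on_le)
    let ?e = "\<lambda>(c, f). f(v := c)"
    show "inj_on ?e (C \<times> P X - B)"
    proof (rule inj_onI, clarify)
      fix c f c' f'
      assume f: "f \<in> P X" "f' \<in> P X" and eq: "f(v := c) = f'(v := c')"
      \<comment> \<open>As \<open>v\<close> lies outside \<open>X\<close>, overwriting the value at
        \<open>v\<close> loses no information about \<open>f\<close>.\<close>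
      have "f v = undefined" "f' v = undefined"
        using f less.prems PiE_arb[of _ X "\<lambda>_. C" v]
        unfolding P_def conflict_free_colorings_def by blast+
      then have "f x = f' x" for x
        by (metis eq fun_upd_apply)
      then have "f = f'" by (rule ext)
      moreover have "c = c'"
        by (metis eq fun_upd_same)
      ultimately show "c = c' \<and> f = f'" by simp
    qed
    show "?e ` (C \<times> P X - B) \<subseteq> P (insert v X)"
    proof (rule image_subsetI, clarify)
      fix c f assume c: "c \<in> C" and f: "f \<in> P X" and nb: "(c, f) \<notin> B"
      have free: "\<not> R c v u" if "u \<in> X" "f u = c" for u
        using nb c f that unfolding B_def bad_def by auto
      have free': "\<not> R c u v" if "u \<in> X" "f u = c" for u
        using free[OF that] sym[OF c] by blast
      have "conflict_free R X f" and fX: "f \<in> X \<rightarrow>\<^sub>E C"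
        using f unfolding P_def conflict_free_colorings_def by auto
      then have "conflict_free R (insert v X) (f(v := c))"
        using less.prems irrefl[OF c] free free' unfolding conflict_free_def by auto
      then show "f(v := c) \<in> P (insert v X)"
        using fX c unfolding P_def conflict_free_colorings_def by (auto simp: PiE_fun_upd)
    qed
    show "finite (P (insert v X))"
      using finP less.prems by simp
  qed
  moreover have "card (C \<times> P X) \<le> card (C \<times> P X - B) + card B"
    using card_Un_le[of "C \<times> P X - B" B] card_mono[of "(C \<times> P X - B) \<union> B" "C \<times> P X"]
      C finP[OF less.prems(1)] finB by (simp add: subset_iff)
  ultimately have main: "card C * card (P X) \<le> card (P (insert v X)) + card B"
    by (simp add: card_cartesian_product)
  have "card C * card (P X) \<le> 2 * card (P (insert v X))"
  proof (cases "card C > 0")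
    case True
    have "4 * d * card (P X) \<le> card C * card (P X)"
      using d by (rule mult_right_mono) simp
    with main cardB[OF True] show ?thesis by linarith
  qed simp
  then show ?case unfolding P_def .
qed

text \<open>The empty set has a coloring, and each insertion multiplies the count by at least the
  positive number \<open>card C / 2\<close>.\<close>

lemma conflict_free_colorings_nonempty:
  assumes "finite C" "C \<noteq> {}" "finite X"
    and "\<And>c x y. c \<in> C \<Longrightarrow> R c x y \<Longrightarrow> R c y x"
    and "\<And>c x. c \<in> C \<Longrightarrow> \<not> R c x x"
    and "\<And>c x. c \<in> C \<Longrightarrow> finite {y. R c x y}"
    and "\<And>c x. c \<in> C \<Longrightarrow> card {y. R c x y} \<le> d"
    and "4 * d \<le> card C"
  shows "conflict_free_colorings R C X \<noteq> {}"
  using \<open>finite X\<close>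
proof (induction X)
  case empty
  show ?case by (auto simp: conflict_free_colorings_def conflict_free_def)
next
  case (insert v X)
  have "0 < card C * card (conflict_free_colorings R C X)"
    using insert assms(1,2) by (simp add: card_gt_0_iff finite_conflict_free_colorings)
  also have "\<dots> \<le> 2 * card (conflict_free_colorings R C (insert v X))"
    using assms insert.hyps by (intro card_colorings_insert) auto
  finally show ?case by (auto simp: card_gt_0_iff)
qed

text \<open>A de Bruijn-Erdos argument: by Tychonoff the space of all maps into the finite discrete
  set \<open>C\<close> is compact, and each pair of points imposes a closed condition.\<close>

lemma conflict_free_compactness:
  fixes R :: "'c \<Rightarrow> 'a \<Rightarrow> 'a \<Rightarrow> bool"
  assumes C: "finite C"
    and fin: "\<And>X. finite X \<Longrightarrow> \<exists>f\<in>X \<rightarrow> C. conflict_free R X f"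
  shows "\<exists>f\<in>UNIV \<rightarrow> C. conflict_free R UNIV f"
proof -
  define T where "T = product_topology (\<lambda>_::'a. discrete_topology C) UNIV"
  define K where "K = (\<lambda>(x, y). {f \<in> topspace T. f y = f x \<longrightarrow> \<not> R (f x) x y})"
  have top: "topspace T = UNIV \<rightarrow> C"
    unfolding T_def by (simp add: PiE_UNIV_domain)
  have closed: "closedin T (K p)" for p
  proof -
    obtain x y where p: "p = (x, y)" by fastforce
    have coord: "closedin T {f \<in> topspace T. f z \<in> A}" if "A \<subseteq> C" for z A
      by (rule closedin_continuous_map_preimage[where Y = "discrete_topology C"])
        (use that in \<open>auto simp: T_def intro: continuous_map_product_coordinates\<close>)
    \<comment> \<open>Either the color of \<open>x\<close> allows no conflict with \<open>y\<close>,
      or the two colors differ. Both are conditions on single coordinates, combined by a union that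
      is finite because \<open>C\<close> is.\<close>
    have "K p = {f \<in> topspace T. f x \<in> {c \<in> C. \<not> R c x y}} \<union>
      (\<Union>c\<in>C. {f \<in> topspace T. f x \<in> {c}} \<inter> {f \<in> topspace T. f y \<in> C - {c}})"
      unfolding K_def p top by auto
    also have "closedin T \<dots>"
    proof (intro closedin_Un closedin_Union)
      show "closedin T {f \<in> topspace T. f x \<in> {c \<in> C. \<not> R c x y}}"
        by (rule coord) auto
    next
      fix S assume "S \<in> (\<lambda>c. {f \<in> topspace T. f x \<in> {c}} \<inter> {f \<in> topspace T. f y \<in> C - {c}}) ` C"
      then obtain c where "c \<in> C"
        and S: "S = {f \<in> topspace T. f x \<in> {c}} \<inter> {f \<in> topspace T. f y \<in> C - {c}}"
        by blast
      then show "closedin T S"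
        unfolding S by (intro closedin_Int coord) auto
    qed (use C in simp)
    finally show ?thesis .
  qed
  have fip: "\<Inter>\<F> \<noteq> {}" if F: "finite \<F>" "\<F> \<subseteq> range K" for \<F>
  proof -
    obtain J where J: "finite J" "\<F> = K ` J"
      using finite_subset_image[OF F] by auto
    define X where "X = fst ` J \<union> snd ` J"
    have "finite X" using J unfolding X_def by simp
    then obtain f where f: "f \<in> X \<rightarrow> C" "conflict_free R X f"
      using fin by blast
    \<comment> \<open>A default color for points outside \<open>X\<close>; it exists because a
      one-point set can be colored.\<close>
    obtain c where c: "c \<in> C"
      using fin[of "{undefined}"] by auto
    have "(\<lambda>x. if x \<in> X then f x else c) \<in> K p" if "p \<in> J" for p
    proof -
      obtain x y where p: "p = (x, y)" by fastforce
      then have "x \<in> X" "y \<in> X" using that unfolding X_def by force+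
      then show ?thesis
        using f c unfolding K_def p top conflict_free_def by auto
    qed
    then show ?thesis unfolding J(2) by blast
  qed
  have "compact_space T"
    unfolding T_def compact_space_product_topology using C by (simp add: compact_space_discrete_topology)
  then have "\<Inter>(range K) \<noteq> {}"
    unfolding compact_space_fip using closed fip by blast
  then obtain f where f: "f \<in> K (x, y)" for x y
    by blast
  then show ?thesis
    unfolding K_def top conflict_free_def by auto
qed

theorem theorem9:
  fixes k :: nat
  shows "upper_chromatic_number k (UNIV :: real set) < \<infinity>"
proof -
  \<comment> \<open>\<open>8 * k\<close> is \<open>4 * d\<close> for the degree bound
    \<open>d = 2 * k\<close>; the extra color keeps the color set nonempty when
    \<open>k = 0\<close>.\<close>
  define m where "m = 8 * k + 1"
  have "always_colorable k m (UNIV :: real set)"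
    unfolding always_colorable_def
  proof (intro allI impI)
    fix D assume D: "positive_array k m D"
    define R where "R c x y \<longleftrightarrow> (\<exists>i\<in>{1..k}. dist x y = D i c)" for c and x y :: real
    have nbrs: "finite {y. R c x y} \<and> card {y. R c x y} \<le> 2 * k" for c x
    proof -
      \<comment> \<open>Dimension one enters here: at most two points of the line lie at a given
        distance from \<open>x\<close>.\<close>
      have sub: "{y. R c x y} \<subseteq> (\<Union>i\<in>{1..k}. {x - D i c, x + D i c})"
        unfolding R_def dist_real_def by (auto simp: abs_if split: if_splits)
      have "card (\<Union>i\<in>{1..k}. {x - D i c, x + D i c}) \<le> (\<Sum>i\<in>{1..k}. card {x - D i c, x + D i c})"
        by (rule card_UN_le) simp
      also have "\<dots> \<le> (\<Sum>i\<in>{1..k}. 2)"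
        by (intro sum_mono) (simp add: card_insert_if)
      finally have "card (\<Union>i\<in>{1..k}. {x - D i c, x + D i c}) \<le> 2 * k"
        by simp
      then show ?thesis
        using sub by (meson card_mono finite.emptyI finite.insertI finite_UN finite_atLeastAtMost
            finite_subset order_trans)
    qed
    have "\<exists>f\<in>UNIV \<rightarrow> {1..m}. conflict_free R UNIV f"
    proof (rule conflict_free_compactness)
      fix X :: "real set" assume "finite X"
      then have "conflict_free_colorings R {1..m} X \<noteq> {}"
      proof (rule conflict_free_colorings_nonempty[where d = "2 * k", rotated 2])
        show "R c y x" if "R c x y" for c x y
          using that unfolding R_def by (simp add: dist_commute)
        \<comment> \<open>Positivity of \<open>D\<close> rules out distance 0;
          \<open>conflict_free\<close> also tests each point against itself.\<close>
        show "\<not> R c x x" if "c \<in> {1..m}" for c x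
          using D that unfolding R_def positive_array_def by force
      qed (use nbrs in \<open>auto simp: m_def\<close>)
      then show "\<exists>f\<in>X \<rightarrow> {1..m}. conflict_free R X f"
        unfolding conflict_free_colorings_def by (auto simp: PiE_def)
    qed simp
    then obtain f where f: "f \<in> UNIV \<rightarrow> {1..m}"
      and free: "\<And>x y. f y = f x \<Longrightarrow> \<not> R (f x) x y"
      unfolding conflict_free_def by blast
    show "array_colorable k m D (UNIV :: real set)"
      unfolding array_colorable_def
    proof (intro bexI[OF _ f] ballI notI, elim bexE conjE)
      fix i j x y
      assume "i \<in> {1..k}" "dist x y = D i j" "f x = j" "f y = j"
      then show False
        using free[of y x] unfolding R_def by auto
    qed
  qed
  then show ?thesis
    unfolding upper_chromatic_number_def by auto
qed

end
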